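(* Let $b_n\ge0$ ($n\ge1$) be real numbers and, for $\mu\in\mathbb R$, let $\overline T^\mu_{b_1,b_2,\dots}=\inf\{n\ge1:|W_n^\mu|\ge b_n\}$. Then $\overline T^\mu_{b_1,b_2,\dots}$ is stochastically increasing in $\mu\in(-\infty,0]$ and stochastically decreasing in $\mu\in[0,\infty)$.
   Context: For $\mu\in\mathbb R$, $(W_n^\mu)_{n\ge0}$ is the normal random walk $W_0^\mu=0$, $W_n^\mu=Z_1^\mu+\cdots+Z_n^\mu$ ($n\ge1$), where $Z_1^\mu,Z_2^\mu,\dots$ are independent and normally distributed with common mean $\mu$ and variance $1$. Convention: $\inf\emptyset=\infty$. A family of $\{1,2,\dots\}\cup\{\infty\}$-valued random variables $T^\mu$ is stochastically increasing (resp. decreasing) in $\mu$ on an interval if for every $n\ge1$ the probability $P(T^\mu>n)$ is non-decreasing (resp. non-increasing) in $\mu$ on that interval (the usual stochastic order). *)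

theory Defs
  imports "HOL-Probability.Probability" "HOL-Library.Extended_Nat"
begin

(* The steps are Z 1, Z 2, ...; the value Z 0 is never used. *)
definition normal_steps :: "'a measure \<Rightarrow> real \<Rightarrow> (nat \<Rightarrow> 'a \<Rightarrow> real) \<Rightarrow> bool" where
  "normal_steps M \<mu> Z \<longleftrightarrow>
     prob_space M \<and>
     prob_space.indep_vars M (\<lambda>_. borel) Z {1..} \<and>
     (\<forall>i\<ge>1. distributed M lborel (Z i) (normal_density \<mu> 1))"

definition walk :: "(nat \<Rightarrow> 'a \<Rightarrow> real) \<Rightarrow> nat \<Rightarrow> 'a \<Rightarrow> real" where
  "walk Z n \<omega> = (\<Sum>i=1..n. Z i \<omega>)"

(* In enat the infimum of the empty set is \<infinity>. *)
definition exit_time :: "(nat \<Rightarrow> real) \<Rightarrow> (nat \<Rightarrow> 'a \<Rightarrow> real) \<Rightarrow> 'a \<Rightarrow> enat" where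
  "exit_time b Z \<omega> = Inf {enat n | n. n \<ge> 1 \<and> \<bar>walk Z n \<omega>\<bar> \<ge> b n}"

(* The usual stochastic order only involves the law of each T \<mu>, so every T \<mu> may live on
   its own probability space M \<mu>. *)
definition stochastically_increasing_on ::
    "real set \<Rightarrow> (real \<Rightarrow> 'a measure) \<Rightarrow> (real \<Rightarrow> 'a \<Rightarrow> enat) \<Rightarrow> bool" where
  "stochastically_increasing_on I M T \<longleftrightarrow>
     (\<forall>n::nat\<ge>1. mono_on I (\<lambda>\<mu>. measure (M \<mu>) {\<omega> \<in> space (M \<mu>). T \<mu> \<omega> > enat n}))"

definition stochastically_decreasing_on ::
    "real set \<Rightarrow> (real \<Rightarrow> 'a measure) \<Rightarrow> (real \<Rightarrow> 'a \<Rightarrow> enat) \<Rightarrow> bool" where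
  "stochastically_decreasing_on I M T \<longleftrightarrow>
     (\<forall>n::nat\<ge>1. antimono_on I (\<lambda>\<mu>. measure (M \<mu>) {\<omega> \<in> space (M \<mu>). T \<mu> \<omega> > enat n}))"

end

theory Submission
  imports Defs
begin

text \<open>
  The exit time exceeds \<open>n\<close> exactly when the walk survives, that is, \<open>\<bar>W\<^sub>k\<bar> < b\<^sub>k\<close> for all
  \<open>1 \<le> k \<le> n\<close>. Both halves of the claim say that the probability of this event
  decreases as \<open>\<bar>\<mu>\<bar>\<close> grows.

  Condition on \<open>W\<^sub>n = x\<close>. Given its endpoint, a Gaussian walk is a bridge whose law does not
  involve the drift, so the conditional survival probability is a function \<open>r\<^sub>n(x)\<close> that is the
  same for every \<open>\<mu>\<close>, and the survival probability is the mean of \<open>r\<^sub>n\<close> under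
  \<open>N(n\<mu>, n)\<close>. Suppose that \<open>r\<^sub>n(x)\<close> decreases in \<open>\<bar>x\<bar>\<close>. Then its mean under
  \<open>N(m, \<sigma>\<^sup>2)\<close> decreases in \<open>\<bar>m\<bar>\<close>, because moving a symmetric unimodal density away
  from the origin reduces its overlap with a symmetric unimodal function
  (\<open>symmetric_unimodal_overlap_antimono\<close>, \<open>normal_integral_antimono\<close>).

  The same one-dimensional fact gives the monotonicity of \<open>r\<^sub>n\<close> by induction: given
  \<open>W\<^bsub>n+1\<^esub> = y\<close>, the position \<open>W\<^sub>n\<close> has the law \<open>N(n y / (n + 1), n / (n + 1))\<close>
  (\<open>normal_density_bridge\<close>), so that \<open>r\<^bsub>n+1\<^esub>(y)\<close> is the indicator of
  \<open>\<bar>y\<bar> < b\<^bsub>n+1\<^esub>\<close> times the mean of \<open>r\<^sub>n\<close> under a normal law whose centre is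
  proportional to \<open>y\<close> (\<open>survival_density_exists\<close>).
\<close>

section \<open>Overlap of symmetric unimodal functions on the line\<close>

lemma rearrangement_two:
  fixes a b p q :: ennreal
  assumes "a \<le> b" "p \<le> q"
  shows "a * q + b * p \<le> a * p + b * q"
proof -
  obtain c d where c: "b = a + c" and d: "q = p + d"
    using assms by (metis le_iff_add)
  show ?thesis
    unfolding c d by (simp add: algebra_simps)
qed

text \<open>
  The one-dimensional case of Anderson's inequality. The reflection about the midpoint of two
  nonnegative centres sends the side of the smaller centre to the other side and away from the
  origin; on the former side both \<open>r\<close> and the translate of \<open>p\<close> with the smaller centre are the
  larger of their two values, and the rearrangement inequality for two terms decides.
\<close>

lemma symmetric_unimodal_overlap_antimono:
  fixes r p :: "real \<Rightarrow> ennreal"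
  assumes r[measurable]: "r \<in> borel_measurable borel"
    and p[measurable]: "p \<in> borel_measurable borel"
    and r_anti: "\<And>x y. \<bar>x\<bar> \<le> \<bar>y\<bar> \<Longrightarrow> r y \<le> r x"
    and p_anti: "\<And>x y. \<bar>x\<bar> \<le> \<bar>y\<bar> \<Longrightarrow> p y \<le> p x"
    and m: "\<bar>m\<bar> \<le> \<bar>m'\<bar>"
  shows "(\<integral>\<^sup>+x. r x * p (x - m') \<partial>lborel) \<le> (\<integral>\<^sup>+x. r x * p (x - m) \<partial>lborel)"
proof -
  define I where "I = (\<lambda>m. \<integral>\<^sup>+x. r x * p (x - m) \<partial>lborel)"
  have r_even: "r (- x) = r x" and p_even: "p (- x) = p x" for x
    by (auto intro!: antisym r_anti p_anti)
  have I_reflect: "I k = (\<integral>\<^sup>+x. r (s - x) * p (s - k - x) \<partial>lborel)" for k s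
    unfolding I_def
    by (subst nn_integral_real_affine[where c="-1" and t=s]) (auto simp: algebra_simps)
  have I_even: "I (- k) = I k" for k
  proof -
    have "p (- k - x) = p (x - (- k))" for x
      using p_even[of "x + k"] by (simp add: algebra_simps)
    then show ?thesis
      unfolding I_reflect[of k 0] by (simp only: I_def diff_0 r_even)
  qed
  have "I k' \<le> I k" if k: "0 \<le> k" "k \<le> k'" for k k'
  proof -
    \<comment> \<open>Averaging each integral with its reflection about the midpoint of the two centres makes
        the comparison pointwise, because the reflection exchanges the two translates of \<open>p\<close>.\<close>
    have double: "I l + I l = (\<integral>\<^sup>+x. r x * p (x - l) + r (k + k' - x) * p (x - l') \<partial>lborel)"
      if "l + l' = k + k'" for l l'
    proof -
      have "p (k + k' - l - x) = p (x - l')" for x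
      proof -
      have "k + k' - l - x = - (x - l')"
        using that by simp
      then show ?thesis
        by (simp only: p_even)
    qed
      then have "I l = (\<integral>\<^sup>+x. r (k + k' - x) * p (x - l') \<partial>lborel)"
        unfolding I_reflect[of l "k + k'"] by simp
      then show ?thesis
        by (subst nn_integral_add) (auto simp: I_def)
    qed
    have "I k' + I k' \<le> I k + I k"
      unfolding double[of k' k, OF add.commute] double[of k k', OF refl]
    proof (rule nn_integral_mono)
      fix x :: real
      show "r x * p (x - k') + r (k + k' - x) * p (x - k)
          \<le> r x * p (x - k) + r (k + k' - x) * p (x - k')"
      proof (cases "2 * x \<le> k + k'")
        case True
        then have "r (k + k' - x) \<le> r x" "p (x - k') \<le> p (x - k)"
          using k by (auto intro!: r_anti p_anti)
        then show ?thesis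
          using rearrangement_two[of "r (k + k' - x)" "r x" "p (x - k')" "p (x - k)"]
          by (simp add: add.commute)
      next
        case False
        then have "r x \<le> r (k + k' - x)" "p (x - k) \<le> p (x - k')"
          using k by (auto intro!: r_anti p_anti)
        then show ?thesis
          by (rule rearrangement_two)
      qed
    qed
    then have "2 * I k' \<le> 2 * I k"
      by (simp add: mult_2)
    then show ?thesis
      by (simp add: ennreal_mult_le_mult_iff)
  qed
  from this[of "\<bar>m\<bar>" "\<bar>m'\<bar>"] m have "I \<bar>m'\<bar> \<le> I \<bar>m\<bar>"
    by simp
  moreover have "I \<bar>k\<bar> = I k" for k
    by (simp add: abs_if I_even)
  ultimately show ?thesis
    by (simp add: I_def)
qed

lemma normal_integral_antimono:
  fixes r :: "real \<Rightarrow> ennreal"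
  assumes "r \<in> borel_measurable borel"
    and "\<And>x y. \<bar>x\<bar> \<le> \<bar>y\<bar> \<Longrightarrow> r y \<le> r x"
    and "\<bar>m\<bar> \<le> \<bar>m'\<bar>"
  shows "(\<integral>\<^sup>+x. r x * ennreal (normal_density m' \<sigma> x) \<partial>lborel)
       \<le> (\<integral>\<^sup>+x. r x * ennreal (normal_density m \<sigma> x) \<partial>lborel)"
proof -
  have "normal_density 0 \<sigma> y \<le> normal_density 0 \<sigma> x" if "\<bar>x\<bar> \<le> \<bar>y\<bar>" for x y
    using that
    by (auto simp: normal_density_def abs_le_square_iff intro!: mult_left_mono divide_right_mono)
  moreover have "normal_density k \<sigma> x = normal_density 0 \<sigma> (x - k)" for k x
    by (simp add: normal_density_def)
  ultimately show ?thesis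
    using symmetric_unimodal_overlap_antimono
        [of r "\<lambda>x. ennreal (normal_density 0 \<sigma> x)" m m'] assms
    by (simp add: ennreal_leI)
qed

section \<open>Survival of the walk given its endpoint\<close>

text \<open>
  Two ways to factor the joint density of \<open>(W\<^sub>t, W\<^bsub>t+1\<^esub>)\<close> at \<open>(x, y)\<close>: forward in time, and as
  the marginal of the endpoint times the bridge. The drift is absent from the bridge factor.
\<close>

lemma normal_density_bridge:
  fixes t :: real
  assumes t: "t > 0"
  shows "normal_density (t * \<mu>) (sqrt t) x * normal_density \<mu> 1 (y - x)
       = normal_density ((t + 1) * \<mu>) (sqrt (t + 1)) y
         * normal_density (t / (t + 1) * y) (sqrt (t / (t + 1))) x"
proof -
  have combine: "1 / c * exp u * (1 / c' * exp u') = 1 / d * exp v * (1 / d' * exp v')"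
    if "c * c' = d * d'" "u + u' = v + v'" for c c' d d' u u' v v' :: real
  proof -
    have "1 / c * exp u * (1 / c' * exp u') = exp (u + u') / (c * c')"
      by (simp add: exp_add)
    also have "\<dots> = 1 / d * exp v * (1 / d' * exp v')"
      unfolding that by (simp add: exp_add)
    finally show ?thesis .
  qed
  have ratio: "t / (t + 1) > 0"
    using t by simp
  have "sqrt (2 * pi * t) * sqrt (2 * pi) = sqrt (2 * pi * (t + 1)) * sqrt (2 * pi * (t / (t + 1)))"
    using t by (simp add: real_sqrt_mult[symmetric] field_simps)
  moreover have "- (x - t * \<mu>)\<^sup>2 / (2 * t) + - (y - x - \<mu>)\<^sup>2 / 2
      = - (y - (t + 1) * \<mu>)\<^sup>2 / (2 * (t + 1)) + - (x - t / (t + 1) * y)\<^sup>2 / (2 * (t / (t + 1)))"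
  proof -
    have "t + 1 \<noteq> 0" "t \<noteq> 0" using t by auto
    then show ?thesis
      by (simp add: divide_simps) (simp add: power2_eq_square algebra_simps)
  qed
  moreover have "(sqrt t)\<^sup>2 = t" "(sqrt (t + 1))\<^sup>2 = t + 1" "(sqrt (t / (t + 1)))\<^sup>2 = t / (t + 1)"
    using t ratio by (intro real_sqrt_pow2; simp)+
  ultimately show ?thesis
    unfolding normal_density_def by (intro combine) (simp_all only: power_one mult_1_right)
qed

definition survives :: "(nat \<Rightarrow> real) \<Rightarrow> (nat \<Rightarrow> 'a \<Rightarrow> real) \<Rightarrow> nat \<Rightarrow> 'a \<Rightarrow> bool" where
  "survives b Z n \<omega> \<longleftrightarrow> (\<forall>k\<in>{1..n}. \<bar>walk Z k \<omega>\<bar> < b k)"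

lemma exit_time_gt_iff: "exit_time b Z \<omega> > enat n \<longleftrightarrow> survives b Z n \<omega>"
proof -
  have "exit_time b Z \<omega> > enat n \<longleftrightarrow> enat (Suc n) \<le> exit_time b Z \<omega>"
    by (simp add: ileI1 Suc_ile_eq)
  also have "\<dots> \<longleftrightarrow> (\<forall>k\<ge>1. \<bar>walk Z k \<omega>\<bar> \<ge> b k \<longrightarrow> Suc n \<le> k)"
    by (auto simp: exit_time_def le_Inf_iff)
  also have "\<dots> \<longleftrightarrow> survives b Z n \<omega>"
    unfolding survives_def by (metis Suc_le_eq atLeastAtMost_iff not_le)
  finally show ?thesis .
qed

lemma walk_Suc: "walk Z (Suc n) \<omega> = walk Z n \<omega> + Z (Suc n) \<omega>"
  by (simp add: walk_def)

lemma survives_Suc: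
  "survives b Z (Suc n) \<omega> \<longleftrightarrow> survives b Z n \<omega> \<and> \<bar>walk Z (Suc n) \<omega>\<bar> < b (Suc n)"
  by (auto simp: survives_def le_Suc_eq)

lemma walk_measurable:
  assumes "\<And>i. i \<in> {1..n} \<Longrightarrow> Z i \<in> borel_measurable N" "k \<le> n"
  shows "walk Z k \<in> borel_measurable N"
  unfolding walk_def using assms by (intro borel_measurable_sum) auto

lemma survives_measurable:
  assumes "\<And>i. i \<in> {1..n} \<Longrightarrow> Z i \<in> borel_measurable N"
  shows "Measurable.pred N (survives b Z n)"
  unfolding survives_def
proof (intro pred_intros_finite)
  show "Measurable.pred N (\<lambda>\<omega>. \<bar>walk Z k \<omega>\<bar> < b k)" if "k \<in> {1..n}" for k
    using walk_measurable[of n Z N k, OF assms] that by (intro borel_measurable_pred_less) auto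
qed auto

lemma normal_steps_measurable:
  assumes "normal_steps M \<mu> Z" "i \<ge> 1"
  shows "Z i \<in> borel_measurable M"
  using assms distributed_measurable[of M lborel "Z i"] by (auto simp: normal_steps_def)

text \<open>
  Fubini for independent variables, with both integrals over the underlying space, so that no
  law has to be named where it is used.
\<close>

lemma (in prob_space) nn_integral_indep_var:
  assumes ind: "indep_var A U B V"
    and g: "g \<in> borel_measurable (A \<Otimes>\<^sub>M B)"
  shows "(\<integral>\<^sup>+\<omega>. g (U \<omega>, V \<omega>) \<partial>M) = (\<integral>\<^sup>+\<omega>'. (\<integral>\<^sup>+\<omega>. g (U \<omega>, V \<omega>') \<partial>M) \<partial>M)"
proof -
  have U[measurable]: "random_variable A U" and V[measurable]: "random_variable B V"
    using ind by (auto dest: indep_var_rv1 indep_var_rv2)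
  interpret DU: prob_space "distr M A U" by (rule prob_space_distr) fact
  interpret DV: prob_space "distr M B V" by (rule prob_space_distr) fact
  interpret P: pair_sigma_finite "distr M A U" "distr M B V" ..
  have g': "g \<in> borel_measurable (distr M A U \<Otimes>\<^sub>M distr M B V)"
    using g by (simp cong: measurable_cong_sets)
  have "(\<integral>\<^sup>+\<omega>. g (U \<omega>, V \<omega>) \<partial>M) = (\<integral>\<^sup>+z. g z \<partial>distr M (A \<Otimes>\<^sub>M B) (\<lambda>\<omega>. (U \<omega>, V \<omega>)))"
    using g by (subst nn_integral_distr) auto
  also have "\<dots> = (\<integral>\<^sup>+z. g z \<partial>(distr M A U \<Otimes>\<^sub>M distr M B V))"
    using ind by (simp add: indep_var_distribution_eq)
  also have "\<dots> = (\<integral>\<^sup>+v. (\<integral>\<^sup>+u. g (u, v) \<partial>distr M A U) \<partial>distr M B V)"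
    using g' by (rule P.nn_integral_snd[symmetric])
  also have "\<dots> = (\<integral>\<^sup>+\<omega>'. (\<integral>\<^sup>+u. g (u, V \<omega>') \<partial>distr M A U) \<partial>M)"
    using g by (subst nn_integral_distr) auto
  also have "\<dots> = (\<integral>\<^sup>+\<omega>'. (\<integral>\<^sup>+\<omega>. g (U \<omega>, V \<omega>') \<partial>M) \<partial>M)"
  proof (rule nn_integral_cong)
    fix \<omega>' assume "\<omega>' \<in> space M"
    then have "V \<omega>' \<in> space B"
      using V by (rule measurable_space[rotated])
    with g show "(\<integral>\<^sup>+u. g (u, V \<omega>') \<partial>distr M A U) = (\<integral>\<^sup>+\<omega>. g (U \<omega>, V \<omega>') \<partial>M)"
      by (subst nn_integral_distr) auto
  qed
  finally show ?thesis .
qed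

lemma nn_integral_survives_Suc:
  fixes h :: "real \<Rightarrow> ennreal"
  assumes steps: "normal_steps M \<mu> Z"
    and h[measurable]: "h \<in> borel_measurable borel"
  shows "(\<integral>\<^sup>+\<omega>. indicator {\<omega>. survives b Z n \<omega>} \<omega> * h (walk Z (Suc n) \<omega>) \<partial>M)
       = (\<integral>\<^sup>+z. ennreal (normal_density \<mu> 1 z) *
            (\<integral>\<^sup>+\<omega>. indicator {\<omega>. survives b Z n \<omega>} \<omega> * h (walk Z n \<omega> + z) \<partial>M) \<partial>lborel)"
proof -
  interpret prob_space M
    using steps by (simp add: normal_steps_def)
  define U where "U = (\<lambda>\<omega>. restrict (\<lambda>i. Z i \<omega>) {1..n})"
  define N where "N = PiM {1..n} (\<lambda>_. borel :: real measure)"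
  define V where "V = (\<lambda>\<omega>. restrict (\<lambda>i. Z i \<omega>) {Suc n})"
  have ind: "indep_var N U (PiM {Suc n} (\<lambda>_. borel)) V"
    using steps unfolding normal_steps_def N_def U_def V_def
    by (intro indep_var_restrict[where I="{1..}"]) auto
  \<comment> \<open>Survival up to \<open>n\<close> and the position at time \<open>n\<close> are functions of the first \<open>n\<close> steps, namely
      the same functionals evaluated on the coordinate process.\<close>
  let ?X = "\<lambda>i (u :: nat \<Rightarrow> real). u i"
  have walk_U: "walk ?X k (U \<omega>) = walk Z k \<omega>" if "k \<le> n" for k \<omega>
    using that by (auto simp: walk_def U_def intro!: sum.cong)
  then have surv_U: "survives b ?X n (U \<omega>) \<longleftrightarrow> survives b Z n \<omega>" for \<omega>
    by (auto simp: survives_def)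
  have X: "?X i \<in> borel_measurable N" if "i \<in> {1..n}" for i
    using that by (simp add: N_def)
  note [measurable] = walk_measurable[of n ?X N n, OF X order_refl]
    survives_measurable[of n ?X N, OF X]
  define g where
    "g = (\<lambda>(u, v :: nat \<Rightarrow> real). indicator {u. survives b ?X n u} u * h (walk ?X n u + v (Suc n)))"
  have "g \<in> borel_measurable (N \<Otimes>\<^sub>M PiM {Suc n} (\<lambda>_. borel))"
    unfolding g_def by measurable
  note fubini = nn_integral_indep_var[OF ind this]
  have Z: "Z i \<in> borel_measurable M" if "i \<in> {1..n}" for i
    using normal_steps_measurable[OF steps] that by auto
  note [measurable] = walk_measurable[of n Z M n, OF Z order_refl]
    survives_measurable[of n Z M, OF Z]
  define F where
    "F = (\<lambda>z. \<integral>\<^sup>+\<omega>. indicator {\<omega>. survives b Z n \<omega>} \<omega> * h (walk Z n \<omega> + z) \<partial>M)"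
  have F: "F \<in> borel_measurable lborel"
    unfolding F_def by measurable
  have "(\<integral>\<^sup>+\<omega>. indicator {\<omega>. survives b Z n \<omega>} \<omega> * h (walk Z (Suc n) \<omega>) \<partial>M)
      = (\<integral>\<^sup>+\<omega>'. F (Z (Suc n) \<omega>') \<partial>M)"
    using fubini by (simp add: g_def F_def V_def surv_U walk_U walk_Suc indicator_def)
  also have "\<dots> = (\<integral>\<^sup>+z. ennreal (normal_density \<mu> 1 z) * F z \<partial>lborel)"
    using steps F by (intro distributed_nn_integral[symmetric]) (auto simp: normal_steps_def)
  finally show ?thesis
    unfolding F_def .
qed

text \<open>
  The recursion for the conditional survival probability: if the position at time \<open>n\<close> on
  survival has density \<open>r\<close> relative to \<open>N(n\<mu>, n)\<close>, then the position one step later has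
  density relative to \<open>N((n + 1)\<mu>, n + 1)\<close> equal to the mean of \<open>r\<close> over the bridge.
\<close>

lemma survival_density_Suc:
  fixes r :: "real \<Rightarrow> ennreal"
  assumes steps: "normal_steps M \<mu> Z" and n: "n \<ge> 1"
    and r[measurable]: "r \<in> borel_measurable borel"
    and r_density: "\<And>h. h \<in> borel_measurable borel \<Longrightarrow>
        (\<integral>\<^sup>+\<omega>. indicator {\<omega>. survives b Z n \<omega>} \<omega> * h (walk Z n \<omega>) \<partial>M)
      = (\<integral>\<^sup>+x. h x * (r x * ennreal (normal_density (real n * \<mu>) (sqrt n) x)) \<partial>lborel)"
    and h[measurable]: "h \<in> borel_measurable borel"
  shows "(\<integral>\<^sup>+\<omega>. indicator {\<omega>. survives b Z n \<omega>} \<omega> * h (walk Z (Suc n) \<omega>) \<partial>M)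
       = (\<integral>\<^sup>+y. h y *
            ((\<integral>\<^sup>+x. r x * ennreal (normal_density (real n / (real n + 1) * y) (sqrt (real n / (real n + 1))) x) \<partial>lborel)
             * ennreal (normal_density (real (Suc n) * \<mu>) (sqrt (Suc n)) y)) \<partial>lborel)"
proof -
  let ?\<phi> = "\<lambda>m s x. ennreal (normal_density m s x)"
  have "(\<integral>\<^sup>+\<omega>. indicator {\<omega>. survives b Z n \<omega>} \<omega> * h (walk Z (Suc n) \<omega>) \<partial>M)
      = (\<integral>\<^sup>+z. ?\<phi> \<mu> 1 z * (\<integral>\<^sup>+x. h (x + z) * (r x * ?\<phi> (real n * \<mu>) (sqrt n) x) \<partial>lborel) \<partial>lborel)"
    unfolding nn_integral_survives_Suc[OF steps h]
    by (subst r_density) auto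
  also have "\<dots> = (\<integral>\<^sup>+z. (\<integral>\<^sup>+x. h (x + z) * (r x * ?\<phi> (real n * \<mu>) (sqrt n) x * ?\<phi> \<mu> 1 z) \<partial>lborel) \<partial>lborel)"
    by (simp add: nn_integral_cmult[symmetric] ac_simps)
  also have "\<dots> = (\<integral>\<^sup>+x. (\<integral>\<^sup>+z. h (x + z) * (r x * ?\<phi> (real n * \<mu>) (sqrt n) x * ?\<phi> \<mu> 1 z) \<partial>lborel) \<partial>lborel)"
    by (rule lborel_pair.Fubini') simp
  also have "\<dots> = (\<integral>\<^sup>+x. (\<integral>\<^sup>+y. h y * (r x * ?\<phi> (real n * \<mu>) (sqrt n) x * ?\<phi> \<mu> 1 (y - x)) \<partial>lborel) \<partial>lborel)"
  proof (rule nn_integral_cong)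
    fix x :: real
    show "(\<integral>\<^sup>+z. h (x + z) * (r x * ?\<phi> (real n * \<mu>) (sqrt n) x * ?\<phi> \<mu> 1 z) \<partial>lborel)
        = (\<integral>\<^sup>+y. h y * (r x * ?\<phi> (real n * \<mu>) (sqrt n) x * ?\<phi> \<mu> 1 (y - x)) \<partial>lborel)"
      by (subst nn_integral_real_affine[where c=1 and t="- x"]) auto
  qed
  also have "\<dots> = (\<integral>\<^sup>+y. (\<integral>\<^sup>+x. h y * (r x * ?\<phi> (real n * \<mu>) (sqrt n) x * ?\<phi> \<mu> 1 (y - x)) \<partial>lborel) \<partial>lborel)"
    by (rule lborel_pair.Fubini') simp
  \<comment> \<open>Only the bridge factor depends on \<open>x\<close>; the rest leaves the inner integral.\<close>
  also have "\<dots> = (\<integral>\<^sup>+y. (\<integral>\<^sup>+x. h y * ?\<phi> (real (Suc n) * \<mu>) (sqrt (Suc n)) y *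
                    (r x * ?\<phi> (real n / (real n + 1) * y) (sqrt (real n / (real n + 1))) x) \<partial>lborel) \<partial>lborel)"
  proof (intro nn_integral_cong)
    fix x y :: real
    have "?\<phi> (real n * \<mu>) (sqrt n) x * ?\<phi> \<mu> 1 (y - x)
        = ?\<phi> (real (Suc n) * \<mu>) (sqrt (Suc n)) y * ?\<phi> (real n / (real n + 1) * y) (sqrt (real n / (real n + 1))) x"
      using normal_density_bridge[of "real n" \<mu> x y] n
      by (simp add: ennreal_mult[symmetric] add.commute)
    then show "h y * (r x * ?\<phi> (real n * \<mu>) (sqrt n) x * ?\<phi> \<mu> 1 (y - x))
        = h y * ?\<phi> (real (Suc n) * \<mu>) (sqrt (Suc n)) y *
            (r x * ?\<phi> (real n / (real n + 1) * y) (sqrt (real n / (real n + 1))) x)"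
      by (metis mult.assoc mult.left_commute)
  qed
  also have "\<dots> = (\<integral>\<^sup>+y. h y *
            ((\<integral>\<^sup>+x. r x * ?\<phi> (real n / (real n + 1) * y) (sqrt (real n / (real n + 1))) x \<partial>lborel)
             * ?\<phi> (real (Suc n) * \<mu>) (sqrt (Suc n)) y) \<partial>lborel)"
    by (subst nn_integral_cmult) (simp_all add: ac_simps)
  finally show ?thesis .
qed

text \<open>
  The point is the order of the quantifiers: one \<open>r\<close> serves all drifts. Testing against
  arbitrary \<open>h\<close>, rather than asking for the total mass alone, is what the recursion needs. The
  induction starts at \<open>n = 1\<close> since the position at time \<open>0\<close> has no density.
\<close>

lemma survival_density_exists:
  fixes M :: "real \<Rightarrow> 'a measure" and Z :: "real \<Rightarrow> nat \<Rightarrow> 'a \<Rightarrow> real"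
  assumes steps: "\<And>\<mu>. normal_steps (M \<mu>) \<mu> (Z \<mu>)" and n: "n \<ge> 1"
  shows "\<exists>r \<in> borel_measurable borel. (\<forall>x y. \<bar>x\<bar> \<le> \<bar>y\<bar> \<longrightarrow> r y \<le> r x) \<and>
    (\<forall>\<mu>. \<forall>h \<in> borel_measurable borel.
        (\<integral>\<^sup>+\<omega>. indicator {\<omega>. survives b (Z \<mu>) n \<omega>} \<omega> * h (walk (Z \<mu>) n \<omega>) \<partial>M \<mu>)
      = (\<integral>\<^sup>+x. h x * ((r x :: ennreal) * ennreal (normal_density (real n * \<mu>) (sqrt n) x)) \<partial>lborel))"
  using n
proof (induction n rule: nat_induct_at_least)
  case base
  let ?r = "indicator {x. \<bar>x\<bar> < b 1} :: real \<Rightarrow> ennreal"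
  show ?case
  proof (intro bexI[of _ ?r] conjI allI ballI impI)
    show "?r \<in> borel_measurable borel"
      by measurable
    show "?r y \<le> ?r x" if "\<bar>x\<bar> \<le> \<bar>y\<bar>" for x y
      using that by (auto simp: indicator_def)
    fix \<mu> and h :: "real \<Rightarrow> ennreal"
    assume h[measurable]: "h \<in> borel_measurable borel"
    have "distributed (M \<mu>) lborel (Z \<mu> 1) (normal_density \<mu> 1)"
      using steps[of \<mu>] by (simp add: normal_steps_def)
    from distributed_nn_integral[OF this, of "\<lambda>x. ?r x * h x"]
    show "(\<integral>\<^sup>+\<omega>. indicator {\<omega>. survives b (Z \<mu>) 1 \<omega>} \<omega> * h (walk (Z \<mu>) 1 \<omega>) \<partial>M \<mu>)
        = (\<integral>\<^sup>+x. h x * (?r x * ennreal (normal_density (real 1 * \<mu>) (sqrt (real 1)) x)) \<partial>lborel)"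
      by (simp add: survives_def walk_def indicator_def ac_simps)
  qed
next
  case (Suc n)
  then obtain r where r[measurable]: "r \<in> borel_measurable borel"
    and r_anti: "\<And>x y. \<bar>x\<bar> \<le> \<bar>y\<bar> \<Longrightarrow> r y \<le> (r x :: ennreal)"
    and r_density: "\<And>\<mu> h. h \<in> borel_measurable borel \<Longrightarrow>
        (\<integral>\<^sup>+\<omega>. indicator {\<omega>. survives b (Z \<mu>) n \<omega>} \<omega> * h (walk (Z \<mu>) n \<omega>) \<partial>M \<mu>)
      = (\<integral>\<^sup>+x. h x * (r x * ennreal (normal_density (real n * \<mu>) (sqrt n) x)) \<partial>lborel)"
    by blast
  let ?I = "indicator {x. \<bar>x\<bar> < b (Suc n)} :: real \<Rightarrow> ennreal"
  define q where "q = (\<lambda>y. \<integral>\<^sup>+x. r x *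
      ennreal (normal_density (real n / (real n + 1) * y) (sqrt (real n / (real n + 1))) x) \<partial>lborel)"
  have [measurable]: "q \<in> borel_measurable borel"
    unfolding q_def normal_density_def by measurable
  have q_anti: "q y \<le> q x" if "\<bar>x\<bar> \<le> \<bar>y\<bar>" for x y
    unfolding q_def using that r_anti
    by (intro normal_integral_antimono) (auto simp: abs_mult intro!: divide_right_mono mult_left_mono)
  show ?case
  proof (intro bexI[of _ "\<lambda>y. ?I y * q y"] conjI allI ballI impI)
    show "(\<lambda>y. ?I y * q y) \<in> borel_measurable borel"
      by measurable
    show "?I y * q y \<le> ?I x * q x" if "\<bar>x\<bar> \<le> \<bar>y\<bar>" for x y
      using that q_anti by (auto simp: indicator_def)
    fix \<mu> and h :: "real \<Rightarrow> ennreal"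
    assume h[measurable]: "h \<in> borel_measurable borel"
    have "(\<integral>\<^sup>+\<omega>. indicator {\<omega>. survives b (Z \<mu>) (Suc n) \<omega>} \<omega> * h (walk (Z \<mu>) (Suc n) \<omega>) \<partial>M \<mu>)
        = (\<integral>\<^sup>+\<omega>. indicator {\<omega>. survives b (Z \<mu>) n \<omega>} \<omega> *
             (?I (walk (Z \<mu>) (Suc n) \<omega>) * h (walk (Z \<mu>) (Suc n) \<omega>)) \<partial>M \<mu>)"
      by (intro nn_integral_cong) (simp add: survives_Suc indicator_def)
    also have "\<dots> = (\<integral>\<^sup>+y. ?I y * h y *
        (q y * ennreal (normal_density (real (Suc n) * \<mu>) (sqrt (Suc n)) y)) \<partial>lborel)"
      unfolding q_def
      using survival_density_Suc[OF steps \<open>n \<ge> 1\<close> r r_density, where h="\<lambda>y. ?I y * h y"]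
      by simp
    finally show "(\<integral>\<^sup>+\<omega>. indicator {\<omega>. survives b (Z \<mu>) (Suc n) \<omega>} \<omega> * h (walk (Z \<mu>) (Suc n) \<omega>) \<partial>M \<mu>)
        = (\<integral>\<^sup>+y. h y * (?I y * q y * ennreal (normal_density (real (Suc n) * \<mu>) (sqrt (Suc n)) y)) \<partial>lborel)"
      by (simp add: ac_simps)
  qed
qed

lemma survival_probability_antimono:
  fixes M :: "real \<Rightarrow> 'a measure" and Z :: "real \<Rightarrow> nat \<Rightarrow> 'a \<Rightarrow> real"
  assumes steps: "\<And>\<mu>. normal_steps (M \<mu>) \<mu> (Z \<mu>)"
    and n: "n \<ge> 1" and \<mu>: "\<bar>\<mu>\<bar> \<le> \<bar>\<mu>'\<bar>"
  shows "measure (M \<mu>') {\<omega> \<in> space (M \<mu>'). exit_time b (Z \<mu>') \<omega> > enat n}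
       \<le> measure (M \<mu>) {\<omega> \<in> space (M \<mu>). exit_time b (Z \<mu>) \<omega> > enat n}"
proof -
  obtain r where r: "r \<in> borel_measurable borel"
    and r_anti: "\<And>x y. \<bar>x\<bar> \<le> \<bar>y\<bar> \<Longrightarrow> r y \<le> (r x :: ennreal)"
    and r_density: "\<And>\<mu> h. h \<in> borel_measurable borel \<Longrightarrow>
        (\<integral>\<^sup>+\<omega>. indicator {\<omega>. survives b (Z \<mu>) n \<omega>} \<omega> * h (walk (Z \<mu>) n \<omega>) \<partial>M \<mu>)
      = (\<integral>\<^sup>+x. h x * (r x * ennreal (normal_density (real n * \<mu>) (sqrt n) x)) \<partial>lborel)"
    using survival_density_exists[OF steps n, of b] by blast
  let ?S = "\<lambda>\<mu>. {\<omega> \<in> space (M \<mu>). survives b (Z \<mu>) n \<omega>}"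
  have prob: "emeasure (M \<mu>) (?S \<mu>)
      = (\<integral>\<^sup>+x. r x * ennreal (normal_density (real n * \<mu>) (sqrt n) x) \<partial>lborel)" for \<mu>
  proof -
    have "Z \<mu> i \<in> borel_measurable (M \<mu>)" if "i \<in> {1..n}" for i
      using normal_steps_measurable[OF steps] that by auto
    then have "?S \<mu> \<in> sets (M \<mu>)"
      using survives_measurable[of n "Z \<mu>" "M \<mu>" b] by (simp add: pred_def)
    then have "emeasure (M \<mu>) (?S \<mu>) = (\<integral>\<^sup>+\<omega>. indicator (?S \<mu>) \<omega> \<partial>M \<mu>)"
      by simp
    also have "\<dots> = (\<integral>\<^sup>+\<omega>. indicator {\<omega>. survives b (Z \<mu>) n \<omega>} \<omega> \<partial>M \<mu>)"
      by (intro nn_integral_cong) (simp add: indicator_def)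
    finally show ?thesis
      using r_density[of "\<lambda>_. 1" \<mu>] by simp
  qed
  have "emeasure (M \<mu>') (?S \<mu>') \<le> emeasure (M \<mu>) (?S \<mu>)"
    unfolding prob using r r_anti \<mu>
    by (intro normal_integral_antimono) (auto simp: abs_mult intro!: mult_left_mono)
  moreover have "emeasure (M \<mu>) (?S \<mu>) < \<infinity>"
  proof -
    interpret prob_space "M \<mu>"
      using steps[of \<mu>] by (simp add: normal_steps_def)
    show ?thesis by (simp add: less_top[symmetric])
  qed
  ultimately show ?thesis
    unfolding exit_time_gt_iff measure_def by (intro enn2real_mono) auto
qed

theorem corollary4:
  fixes M :: "real \<Rightarrow> 'a measure"
    and Z :: "real \<Rightarrow> nat \<Rightarrow> 'a \<Rightarrow> real"
    and b :: "nat \<Rightarrow> real"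
  assumes "\<And>\<mu>. normal_steps (M \<mu>) \<mu> (Z \<mu>)"
    and "\<And>n. n \<ge> 1 \<Longrightarrow> b n \<ge> 0"
  shows "stochastically_increasing_on {..0} M (\<lambda>\<mu>. exit_time b (Z \<mu>))
       \<and> stochastically_decreasing_on {0..} M (\<lambda>\<mu>. exit_time b (Z \<mu>))"
  unfolding stochastically_increasing_on_def stochastically_decreasing_on_def monotone_on_def
  using survival_probability_antimono[OF assms(1)] by auto

end
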